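(* Let $G$ be a weakly $f$-equitable graph with quotient matrices $B(c)$ and quotient graphs $G_c$, where $c$ ranges over the colors of $f$. Define $B^*(c)=D_\nu B(c)D_\nu^{-1}$ and let $G_c^*$ be the graph whose adjacency matrix is $B^*(c)$. Then, for any vertices $u$ and $v$ in $G$, \begin{align*} H(G;(v,u))&=H(G_{c_v};(c_v,v_u)),\\ H_m(G;(v,u))&=H(G_{c_v}^*;(c_v,v_u)), \end{align*} where $c_v=f(v,v)$ and $v_u=f(v,u)$.
   Context: The graph $G$ is finite, connected and undirected, with vertex set $V$ and adjacency matrix $A$; $G(u)$ is the set of neighbours of $u$. For a nonnegative square matrix $M=(m_{ij})$, $T(M)$ is the matrix with $(i,j)$-entry $m_{ij}/\sum_l m_{lj}$, read as the transition probability from $j$ to $i$. The simple random walk on $G$ has transition matrix $T(A)$. Let $\lambda_1$ be the largest eigenvalue of $A$ and $\nu=(\nu_u)_{u\in V}$ its positive unit eigenvector (Perron eigenvector). The maximal entropy random walk on $G$ has transition matrix $T(\mathrm{diag}(\nu) A)$, i.e. it moves from $u$ to $v\in G(u)$ with probability $\nu_v/\sum_{x\in G(u)}\nu_x$. $H(G;(v,u))$ and $H_m(G;(v,u))$ are the expected numbers of steps needed by the simple, respectively maximal entropy, random walk started at $u$ to reach $v$ for the first time; both are $0$ when $u=v$. For a partition $P=\{V_0,\ldots,V_m\}$ of $V$ (empty blocks allowed): $P$ is equitable if for all $i,j$ the number $|G(u)\cap V_i|$ is the same number $b_{ij}$ for all $u\in V_j$; then $B=(b_{ij})$ (indexed by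 nonempty blocks) is its quotient matrix and the quotient graph is the weighted directed graph (loops allowed) on the nonempty blocks with adjacency matrix $B$. For $u\in V_j$ put $b^*_{ij}(u)=\frac{1}{\nu_u}\sum_{v\in G(u)\cap V_i}\nu_v$; $P$ is weight-equitable if for all $i,j$, $b^*_{ij}(u)$ is the same number $b^*_{ij}$ for all $u\in V_j$; then $(b^*_{ij})$ is its weight-regular quotient matrix, and the weight-quotient graph is the weighted directed graph on the nonempty blocks with this adjacency matrix. Weakly weight-$f$-equitable graphs: let $f:V\times V\to\{c_1,\ldots,c_s,x_1,\ldots,x_r\}$ (distinct values) with $f(v,u)\in\{c_1,\ldots,c_s\}$ if $u=v$ and $f(v,u)\in\{x_1,\ldots,x_r\}$ if $u\neq v$. The elements $c_i$ are the colors of $f$. For $o\in V$ and a value $x$ let $F_x(o)=\{u\in V:f(o,u)=x\}$ and $P_o=\{F_{f(o,o)}(o),F_{x_1}(o),\ldots,F_{x_r}(o)\}$. $G$ is weakly weight-$f$-equitable if for all $o$: (i) $F_{f(o,o)}(o)=\{o\}$; (ii) $P_o$ is weight-equitable; (iii) the weight-quotient graph of $P_o$, with each block $F_x(o)$ identified with its label $x$, depends only on $f(o,o)$. $G$ is weakly $f$-equitable if it is weakly weight-$f$-equitable and every $P_o$ is equitable. For a color $c$, $B(c)$ and $G_c$ denote the quotient matrix and quotient graph (indexed by labels) of $P_o$ for vertices $o$ with $f(o,o)=c$; it is part of this notation that they depend only on $c$. For an equitable partition, $\nu$ is constant on each block (known fact); in $B^*(c)=D_\nu B(c)D_\nu^{-1}$,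 $D_\nu$ is the diagonal matrix indexed by the labels of the nonempty blocks of $P_o$ (where $f(o,o)=c$) whose entry at a label is the common value of $\nu$ on that block. For a weighted directed graph $Q$ with adjacency matrix $M$, the simple random walk on $Q$ is the Markov chain with transition matrix $T(M)$ (applied to $G_c$ with $M=B(c)$ and to $G_c^*$ with $M=B^*(c)$), and $H(Q;(x,y))$ is the expected number of steps to first reach $x$ starting from $y$, with value $0$ when $x=y$. *)

theory Defs
  imports "HOL-Probability.Probability"
begin

section \<open>Markov chains and expected hitting times\<close>

text \<open>
  A nonnegative matrix with finite index set \<open>S\<close> is a function \<open>M\<close>, with \<open>M i j\<close> the
  \<open>(i, j)\<close>-entry; entries outside \<open>S \<times> S\<close> are ignored. The same data serves as a weighted
  directed graph with vertex set \<open>S\<close>. Columns sum to one in \<open>trans_matrix S M\<close>: the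
  \<open>(i, j)\<close>-entry is the probability of a step from \<open>j\<close> to \<open>i\<close>.
\<close>

definition trans_matrix :: "'a set \<Rightarrow> ('a \<Rightarrow> 'a \<Rightarrow> real) \<Rightarrow> 'a \<Rightarrow> 'a \<Rightarrow> real" where
  "trans_matrix S M i j =
     (if i \<in> S \<and> j \<in> S then M i j / (\<Sum>l\<in>S. M l j) else 0)"

text \<open>
  If column \<open>j\<close> of the transition matrix does not sum to one (zero column of \<open>M\<close>, or
  \<open>j \<notin> S\<close>), then \<open>embed_pmf\<close> is an unspecified probability mass function. For the walks below
  this only happens on the one-vertex graph, where every walk starts at its target.
\<close>

definition step_pmf :: "'a set \<Rightarrow> ('a \<Rightarrow> 'a \<Rightarrow> real) \<Rightarrow> 'a \<Rightarrow> 'a pmf" where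
  "step_pmf S M j = embed_pmf (\<lambda>i. trans_matrix S M i j)"

definition walk_kernel ::
  "'a set \<Rightarrow> ('a \<Rightarrow> 'a \<Rightarrow> real) \<Rightarrow> 'a \<Rightarrow> nat \<Rightarrow> (nat \<Rightarrow> 'a) \<Rightarrow> 'a measure" where
  "walk_kernel S M y n \<omega> =
     (if n = 0 then return (count_space UNIV) y
      else measure_pmf (step_pmf S M (\<omega> (n - 1))))"

lemma Ionescu_Tulcea_walk_kernel:
  "Ionescu_Tulcea (walk_kernel S M y) (\<lambda>_. count_space UNIV)"
proof (rule Ionescu_Tulcea.intro)
  show "walk_kernel S M y n \<in>
    measurable (PiM {0..<n} (\<lambda>_. count_space UNIV)) (subprob_algebra (count_space UNIV))" for n
  proof (cases "n = 0")
    case True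
    then show ?thesis
      by (simp add: walk_kernel_def[abs_def] space_subprob_algebra prob_space_return
          prob_space_imp_subprob_space)
  next
    case False
    have K: "(\<lambda>x. measure_pmf (step_pmf S M x)) \<in>
        measurable (count_space UNIV) (subprob_algebra (count_space UNIV))"
      by (rule measurable_measure_pmf)
    have C: "(\<lambda>\<omega>. \<omega> (n - 1)) \<in>
        measurable (PiM {0..<n} (\<lambda>_. count_space UNIV)) (count_space UNIV)"
      using False by (intro measurable_component_singleton) auto
    show ?thesis
      using measurable_compose[OF C K] False by (simp add: walk_kernel_def[abs_def])
  qed
  show "prob_space (walk_kernel S M y n \<omega>)" for n \<omega>
    by (auto simp: walk_kernel_def prob_space_return prob_space_measure_pmf)
qed

text \<open>The law, on the space of trajectories, of the walk with transition matrix
  \<open>trans_matrix S M\<close> started at \<open>y\<close> (Ionescu-Tulcea extension of the kernels).\<close>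

definition walk_measure ::
  "'a set \<Rightarrow> ('a \<Rightarrow> 'a \<Rightarrow> real) \<Rightarrow> 'a \<Rightarrow> (nat \<Rightarrow> 'a) measure" where
  "walk_measure S M y =
     projective_family.lim UNIV
       (Ionescu_Tulcea.CI (walk_kernel S M y) (\<lambda>_. count_space UNIV))
       (\<lambda>_. count_space UNIV)"

text \<open>The hitting time is \<open>\<infinity>\<close> on trajectories that never reach \<open>x\<close>.\<close>

definition hitting_time :: "'a \<Rightarrow> (nat \<Rightarrow> 'a) \<Rightarrow> ennreal" where
  "hitting_time x \<omega> = (INF n\<in>{n. \<omega> n = x}. of_nat n)"

text \<open>\<open>expected_hitting S M x y\<close> has the target \<open>x\<close> first and the starting point \<open>y\<close> second.\<close>

definition expected_hitting :: "'a set \<Rightarrow> ('a \<Rightarrow> 'a \<Rightarrow> real) \<Rightarrow> 'a \<Rightarrow> 'a \<Rightarrow> ennreal" where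
  "expected_hitting S M x y = (\<integral>\<^sup>+ \<omega>. hitting_time x \<omega> \<partial>walk_measure S M y)"


section \<open>Graphs, the Perron eigenvector and the two random walks\<close>

definition connected_graph :: "('v::finite \<Rightarrow> 'v \<Rightarrow> bool) \<Rightarrow> bool" where
  "connected_graph E \<longleftrightarrow> symp E \<and> irreflp E \<and> (\<forall>u v. E\<^sup>*\<^sup>* u v)"

definition nbrs :: "('v \<Rightarrow> 'v \<Rightarrow> bool) \<Rightarrow> 'v \<Rightarrow> 'v set" where
  "nbrs E u = {v. E u v}"

definition adj_matrix :: "('v::finite \<Rightarrow> 'v \<Rightarrow> bool) \<Rightarrow> real ^ 'v ^ 'v" where
  "adj_matrix E = (\<chi> i j. if E i j then 1 else 0)"

definition diag_matrix :: "real ^ 'v \<Rightarrow> real ^ 'v ^ 'v" where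
  "diag_matrix d = (\<chi> i j. if i = j then d $ i else 0)"

definition matrix_eigenvalue :: "real ^ 'v ^ 'v \<Rightarrow> real \<Rightarrow> bool" where
  "matrix_eigenvalue A k \<longleftrightarrow> (\<exists>w. w \<noteq> 0 \<and> A *v w = k *\<^sub>R w)"

definition perron_eigenvector :: "real ^ 'v ^ 'v \<Rightarrow> real ^ 'v \<Rightarrow> bool" where
  "perron_eigenvector A \<nu> \<longleftrightarrow>
     (\<exists>k. matrix_eigenvalue A k \<and> (\<forall>k'. matrix_eigenvalue A k' \<longrightarrow> k' \<le> k) \<and>
          A *v \<nu> = k *\<^sub>R \<nu>) \<and>
     norm \<nu> = 1 \<and> (\<forall>u. \<nu> $ u > 0)"

definition H_simple :: "('v::finite \<Rightarrow> 'v \<Rightarrow> bool) \<Rightarrow> 'v \<Rightarrow> 'v \<Rightarrow> ennreal" where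
  "H_simple E v u = expected_hitting UNIV (\<lambda>i j. adj_matrix E $ i $ j) v u"

definition H_maxent :: "('v::finite \<Rightarrow> 'v \<Rightarrow> bool) \<Rightarrow> real ^ 'v \<Rightarrow> 'v \<Rightarrow> 'v \<Rightarrow> ennreal" where
  "H_maxent E \<nu> v u =
     expected_hitting UNIV (\<lambda>i j. (diag_matrix \<nu> ** adj_matrix E) $ i $ j) v u"


section \<open>Equitable and weight-equitable partitions\<close>

text \<open>Partitions are families \<open>P\<close> of blocks indexed by a set \<open>I\<close> of labels; blocks may be empty.\<close>

definition indexed_partition :: "'l set \<Rightarrow> ('l \<Rightarrow> 'v set) \<Rightarrow> bool" where
  "indexed_partition I P \<longleftrightarrow> disjoint_family_on P I \<and> (\<Union>i\<in>I. P i) = UNIV"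

definition nonempty_labels :: "'l set \<Rightarrow> ('l \<Rightarrow> 'v set) \<Rightarrow> 'l set" where
  "nonempty_labels I P = {i \<in> I. P i \<noteq> {}}"

definition equitable :: "('v \<Rightarrow> 'v \<Rightarrow> bool) \<Rightarrow> 'l set \<Rightarrow> ('l \<Rightarrow> 'v set) \<Rightarrow> bool" where
  "equitable E I P \<longleftrightarrow> indexed_partition I P \<and>
     (\<forall>i\<in>I. \<forall>j\<in>I. \<exists>b. \<forall>u\<in>P j. card (nbrs E u \<inter> P i) = b)"

text \<open>\<open>B\<close> is determined by this only on the labels of nonempty blocks.\<close>

definition is_quotient_matrix ::
  "('v \<Rightarrow> 'v \<Rightarrow> bool) \<Rightarrow> 'l set \<Rightarrow> ('l \<Rightarrow> 'v set) \<Rightarrow> ('l \<Rightarrow> 'l \<Rightarrow> real) \<Rightarrow> bool" where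
  "is_quotient_matrix E I P B \<longleftrightarrow>
     (\<forall>i\<in>nonempty_labels I P. \<forall>j\<in>nonempty_labels I P.
        \<forall>u\<in>P j. real (card (nbrs E u \<inter> P i)) = B i j)"

definition rel_weight ::
  "('v::finite \<Rightarrow> 'v \<Rightarrow> bool) \<Rightarrow> real ^ 'v \<Rightarrow> 'v set \<Rightarrow> 'v \<Rightarrow> real" where
  "rel_weight E \<nu> Q u = 1 / \<nu> $ u * (\<Sum>v\<in>nbrs E u \<inter> Q. \<nu> $ v)"

definition weight_equitable ::
  "('v::finite \<Rightarrow> 'v \<Rightarrow> bool) \<Rightarrow> real ^ 'v \<Rightarrow> 'l set \<Rightarrow> ('l \<Rightarrow> 'v set) \<Rightarrow> bool" where
  "weight_equitable E \<nu> I P \<longleftrightarrow> indexed_partition I P \<and>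
     (\<forall>i\<in>I. \<forall>j\<in>I. \<exists>b. \<forall>u\<in>P j. rel_weight E \<nu> (P i) u = b)"

definition is_weight_quotient_matrix ::
  "('v::finite \<Rightarrow> 'v \<Rightarrow> bool) \<Rightarrow> real ^ 'v \<Rightarrow> 'l set \<Rightarrow> ('l \<Rightarrow> 'v set) \<Rightarrow>
     ('l \<Rightarrow> 'l \<Rightarrow> real) \<Rightarrow> bool" where
  "is_weight_quotient_matrix E \<nu> I P W \<longleftrightarrow>
     (\<forall>i\<in>nonempty_labels I P. \<forall>j\<in>nonempty_labels I P.
        \<forall>u\<in>P j. rel_weight E \<nu> (P i) u = W i j)"


section \<open>Weakly equitable graphs\<close>

text \<open>\<open>C\<close> is the set of colors \<open>c\<^sub>1, \<dots>, c\<^sub>s\<close>, and \<open>X\<close> is the set of the remaining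
  values \<open>x\<^sub>1, \<dots>, x\<^sub>r\<close>; not all of them have to be attained.\<close>

definition labelling :: "'l set \<Rightarrow> 'l set \<Rightarrow> ('v \<Rightarrow> 'v \<Rightarrow> 'l) \<Rightarrow> bool" where
  "labelling C X f \<longleftrightarrow> finite C \<and> finite X \<and> C \<inter> X = {} \<and>
     (\<forall>v u. if u = v then f v u \<in> C else f v u \<in> X)"

text \<open>\<open>fblock f z x\<close> is the block \<open>F\<^sub>x(z)\<close>; the partition \<open>P\<^sub>z\<close> is \<open>fblock f z\<close> with
  index set \<open>part_labels X f z\<close>.\<close>

definition fblock :: "('v \<Rightarrow> 'v \<Rightarrow> 'l) \<Rightarrow> 'v \<Rightarrow> 'l \<Rightarrow> 'v set" where
  "fblock f z x = {u. f z u = x}"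

definition part_labels :: "'l set \<Rightarrow> ('v \<Rightarrow> 'v \<Rightarrow> 'l) \<Rightarrow> 'v \<Rightarrow> 'l set" where
  "part_labels X f z = insert (f z z) X"

text \<open>The last conjunct says that the weight-quotient graph of \<open>P\<^sub>z\<close> (vertex set and weights)
  is a function of \<open>f z z\<close>.\<close>

definition weakly_weight_f_equitable ::
  "('v::finite \<Rightarrow> 'v \<Rightarrow> bool) \<Rightarrow> real ^ 'v \<Rightarrow> 'l set \<Rightarrow> 'l set \<Rightarrow> ('v \<Rightarrow> 'v \<Rightarrow> 'l) \<Rightarrow> bool"
where
  "weakly_weight_f_equitable E \<nu> C X f \<longleftrightarrow> labelling C X f \<and>
     (\<forall>z. fblock f z (f z z) = {z}) \<and>
     (\<forall>z. weight_equitable E \<nu> (part_labels X f z) (fblock f z)) \<and>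
     (\<exists>L W. \<forall>z. nonempty_labels (part_labels X f z) (fblock f z) = L (f z z) \<and>
        is_weight_quotient_matrix E \<nu> (part_labels X f z) (fblock f z) (W (f z z)))"

definition weakly_f_equitable ::
  "('v::finite \<Rightarrow> 'v \<Rightarrow> bool) \<Rightarrow> real ^ 'v \<Rightarrow> 'l set \<Rightarrow> 'l set \<Rightarrow> ('v \<Rightarrow> 'v \<Rightarrow> 'l) \<Rightarrow> bool"
where
  "weakly_f_equitable E \<nu> C X f \<longleftrightarrow> weakly_weight_f_equitable E \<nu> C X f \<and>
     (\<forall>z. equitable E (part_labels X f z) (fblock f z))"

text \<open>\<open>L c\<close> and \<open>B c\<close> are the vertex set and the adjacency matrix of the quotient graph of
  \<open>P\<^sub>z\<close> for every \<open>z\<close> of color \<open>c\<close>; in particular these depend only on the color.\<close>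

definition quotient_graphs ::
  "('v \<Rightarrow> 'v \<Rightarrow> bool) \<Rightarrow> 'l set \<Rightarrow> ('v \<Rightarrow> 'v \<Rightarrow> 'l) \<Rightarrow>
     ('l \<Rightarrow> 'l set) \<Rightarrow> ('l \<Rightarrow> 'l \<Rightarrow> 'l \<Rightarrow> real) \<Rightarrow> bool" where
  "quotient_graphs E X f L B \<longleftrightarrow>
     (\<forall>z. L (f z z) = nonempty_labels (part_labels X f z) (fblock f z) \<and>
          is_quotient_matrix E (part_labels X f z) (fblock f z) (B (f z z)))"

text \<open>The diagonal of \<open>D\<^sub>\<nu>\<close>, read off from \<open>P\<^sub>z\<close>: the common value of \<open>\<nu>\<close> on each block.\<close>

definition D_diag :: "real ^ 'v \<Rightarrow> ('v \<Rightarrow> 'v \<Rightarrow> 'l) \<Rightarrow> 'v \<Rightarrow> 'l \<Rightarrow> real" where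
  "D_diag \<nu> f z x = (THE a. \<forall>u\<in>fblock f z x. \<nu> $ u = a)"

text \<open>\<open>D B D\<^sup>-\<^sup>1\<close> for the diagonal matrix \<open>D\<close> with diagonal \<open>d\<close>.\<close>

definition diag_conj :: "('l \<Rightarrow> real) \<Rightarrow> ('l \<Rightarrow> 'l \<Rightarrow> real) \<Rightarrow> 'l \<Rightarrow> 'l \<Rightarrow> real" where
  "diag_conj d B i j = d i * B i j * inverse (d j)"

end

theory Submission
  imports Defs
begin

text \<open>
  The map \<open>u \<mapsto> f v u\<close> sends a walk on the graph to a walk on the labels of
  \<open>P\<^sub>v\<close>. For both walks on the graph the probability of stepping from \<open>u
  \<noteq> v\<close> into a block is a function of the block containing \<open>u\<close>, and it
  equals the step probability of the corresponding quotient walk. So the image of the graph walk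
  moves as the quotient walk until \<open>v\<close> is reached. The block of the label \<open>f v
  v\<close> is \<open>{v}\<close>, hence the graph walk sits at \<open>v\<close> exactly when its
  image sits at \<open>f v v\<close>, and the hitting times have the same expectation
  (\<open>expected_hitting_lump\<close>).

  To compare the two expectations, write each hitting time as a tail sum: its expectation is the sum
  of the probabilities of avoiding the target up to time \<open>n\<close>, and these are obtained by
  iterating on the starting point the one-step operator of the walk killed at the target
  (\<open>expected_hitting_eq_suminf\<close>); this operator commutes with composition with the
  lumping map.

  For the simple random walk the block sums of a column of the adjacency matrix are the entries of
  \<open>B\<close>. For the maximal entropy walk they are the entries of the weight-regular quotient matrix, up
  to the factor \<open>\<nu> $ u\<close>, which normalization removes. This matrix is \<open>D B D\<^sup>-\<^sup>1\<close> because \<open>\<nu>\<close> is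
  constant on blocks (\<open>weight_constant_on_blocks\<close>): starting from the singleton block, constancy
  spreads along edges. The vertex \<open>z\<close> that supplies \<open>D\<close> may differ from \<open>v\<close>, so the two vectors
  of block values may differ too; but the weight-regular quotient matrix depends only on the color,
  and therefore so does \<open>D B D\<^sup>-\<^sup>1\<close>.
\<close>

section \<open>Expected hitting times through the killed walk\<close>

text \<open>The usual tail sum of an \<open>\<nat> \<union> {\<infinity>}\<close>-valued variable. Avoiding the target up to time \<open>n\<close> is
  split into avoiding it before time \<open>n\<close> and a function of the position at time \<open>n\<close>, the form in
  which the Markov property applies.\<close>

lemma hitting_time_eq_suminf:
  "hitting_time x \<omega> =
     (\<Sum>n. if \<forall>i<n. \<omega> i \<noteq> x then if \<omega> n = x then 0 else 1 else 0)"
  (is "_ = (\<Sum>n. ?s n)")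
proof (cases "\<exists>n. \<omega> n = x")
  case False
  then have "hitting_time x \<omega> = \<infinity>"
    by (simp add: hitting_time_def)
  moreover from False have "(\<Sum>n. ?s n) = (\<Sum>n. 1)"
    by (intro suminf_cong) auto
  moreover have "(\<Sum>n. 1 :: ennreal) = \<infinity>"
  proof (rule ccontr)
    assume "(\<Sum>n. 1 :: ennreal) \<noteq> \<infinity>"
    then have "summable (\<lambda>n::nat. 1 :: real)"
      using summable_suminf_not_top[of "\<lambda>_. 1"] by simp
    then show False by (simp add: summable_const_iff)
  qed
  ultimately show ?thesis by simp
next
  case True
  define N where "N = (LEAST n. \<omega> n = x)"
  have N: "\<omega> N = x" unfolding N_def using True by (rule LeastI_ex)
  have less_N: "\<omega> n \<noteq> x" if "n < N" for n
    using that not_less_Least unfolding N_def by blast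
  have s: "?s n = (if n < N then 1 else 0)" for n
    using N less_N by (auto simp: not_less) (metis le_neq_implies_less)
  have "hitting_time x \<omega> = of_nat N"
    unfolding hitting_time_def
  proof (rule antisym)
    show "(INF n\<in>{n. \<omega> n = x}. of_nat n) \<le> (of_nat N :: ennreal)"
      using N by (intro INF_lower) simp
    show "(of_nat N :: ennreal) \<le> (INF n\<in>{n. \<omega> n = x}. of_nat n)"
      using less_N by (intro INF_greatest) (auto simp: not_less[symmetric])
  qed
  also have "\<dots> = (\<Sum>n<N. ?s n)"
    unfolding s by simp
  also have "\<dots> = (\<Sum>n. ?s n)"
    by (rule suminf_finite[symmetric]) (auto simp: s)
  finally show ?thesis .
qed

lemma measurable_killed_trajectory:
  fixes \<phi> :: "'a \<Rightarrow> ennreal" and n :: nat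
  assumes "{..n} \<subseteq> I"
  shows "(\<lambda>\<omega>. if \<forall>i<n. \<omega> i \<noteq> x then \<phi> (\<omega> n) else 0)
    \<in> borel_measurable (PiM I (\<lambda>_. count_space UNIV))"
    (is "_ \<in> borel_measurable ?M")
proof (intro measurable_If)
  have coord: "(\<lambda>\<omega>. \<omega> i) \<in> measurable ?M (count_space UNIV)" if "i \<le> n" for i
    by (rule measurable_component_singleton) (use that assms in auto)
  show "(\<lambda>\<omega>. \<phi> (\<omega> n)) \<in> borel_measurable ?M"
    by (rule measurable_compose[OF coord[OF order_refl]]) auto
  have "(\<lambda>\<omega>. \<omega> i \<noteq> x) \<in> measurable ?M (count_space UNIV)" if "i < n" for i
    by (rule measurable_compose[OF coord]) (use that in auto)
  then have "Measurable.pred ?M (\<lambda>\<omega>. \<forall>i\<in>{..<n}. \<omega> i \<noteq> x)"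
    by (intro pred_intros_finite) auto
  then show "{\<omega> \<in> space ?M. \<forall>i<n. \<omega> i \<noteq> x} \<in> sets ?M"
    by (simp only: pred_def Ball_def lessThan_iff)
qed (rule measurable_const, simp)

text \<open>The one-step operator of the walk killed at \<open>x\<close>, acting on functions of the starting point.\<close>

definition killed_step :: "('a \<Rightarrow> 'a pmf) \<Rightarrow> 'a \<Rightarrow> ('a \<Rightarrow> ennreal) \<Rightarrow> 'a \<Rightarrow> ennreal" where
  "killed_step K x \<phi> a = (if a = x then 0 else \<integral>\<^sup>+ b. \<phi> b \<partial>measure_pmf (K a))"

text \<open>The Markov property, by peeling off the last step: integrating out the position at time
  \<open>n + 1\<close> replaces \<open>\<phi>\<close> by \<open>killed_step K x \<phi>\<close> evaluated at time \<open>n\<close>.\<close>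

lemma nn_integral_walk_killed:
  "(\<integral>\<^sup>+ \<omega>. (if \<forall>i<n. \<omega> i \<noteq> x then \<phi> (\<omega> n) else 0) \<partial>walk_measure S M y) =
     (killed_step (step_pmf S M) x ^^ n) \<phi> y"
proof -
  interpret IT: Ionescu_Tulcea "walk_kernel S M y" "\<lambda>_. count_space UNIV"
    by (rule Ionescu_Tulcea_walk_kernel)
  let ?PiM = "\<lambda>n. PiM {0..<n} (\<lambda>_::nat. count_space (UNIV :: 'a set))"
  let ?C = "\<lambda>n. IT.C 0 n (\<lambda>_. undefined)"
  let ?f = "\<lambda>n \<phi> \<omega>. if \<forall>i<n. \<omega> i \<noteq> x then \<phi> (\<omega> n) else (0::ennreal)"
  have meas: "?f n \<phi> \<in> borel_measurable (?PiM (Suc n))" for n and \<phi> :: "'a \<Rightarrow> ennreal"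
    by (rule measurable_killed_trajectory) auto
  \<comment> \<open>The integrand depends on finitely many coordinates, so the integral over trajectories
    reduces to the iterated kernels.\<close>
  have dC: "distr IT.PF.lim (?PiM n) (\<lambda>\<omega>. restrict \<omega> {0..<n}) = ?C n" for n
  proof -
    have "IT.up_to {0..<n} = n"
      using IT.up_to[of "{0..<n}"] by (intro antisym) (auto simp: IT.up_to_iff_Ico)
    then show ?thesis
      using IT.distr_lim[of "{0..<n}"] IT.distr_C[of n n "\<lambda>_. undefined" 0]
      by (simp add: IT.CI_def)
  qed
  have "(\<integral>\<^sup>+ \<omega>. ?f n \<phi> \<omega> \<partial>walk_measure S M y) = (\<integral>\<^sup>+ \<omega>. ?f n \<phi> \<omega> \<partial>?C (Suc n))"
    unfolding dC[symmetric] walk_measure_def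
    by (subst nn_integral_distr)
      (auto intro!: nn_integral_cong measurable_restrict measurable_component_singleton meas
        simp: measurable_cong_sets[OF IT.PF.sets_lim refl] simp del: IT.C.simps)
  also have "\<dots> = (killed_step (step_pmf S M) x ^^ n) \<phi> y"
  proof (induction n arbitrary: \<phi>)
    case 0
    have start: "(\<lambda>_. undefined) \<in> space (?PiM 0)"
      by (simp add: space_PiM)
    have "?C (Suc 0) = IT.eP 0 (\<lambda>_. undefined)"
      using bind_return[OF IT.measurable_eP start] by simp
    then have "(\<integral>\<^sup>+ \<omega>. ?f 0 \<phi> \<omega> \<partial>?C (Suc 0)) =
        (\<integral>\<^sup>+ b. \<phi> b \<partial>walk_kernel S M y 0 (\<lambda>_. undefined))"
      using IT.nn_integral_eP[OF start meas[of 0 \<phi>]] by simp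
    also have "\<dots> = \<phi> y"
      by (simp add: walk_kernel_def nn_integral_return)
    finally show ?case by simp
  next
    case (Suc n)
    have "sets (?C (Suc n)) = sets (?PiM (Suc n))"
      using IT.sets_C[of "\<lambda>_. undefined" 0 "Suc n"] by (simp add: space_PiM del: IT.C.simps)
    from measurable_cong_sets[OF this refl] IT.measurable_eP[of "Suc n"]
    have eP: "IT.eP (Suc n) \<in> measurable (?C (Suc n)) (subprob_algebra (?PiM (Suc (Suc n))))"
      by blast
    have "(\<integral>\<^sup>+ \<omega>. ?f (Suc n) \<phi> \<omega> \<partial>?C (Suc (Suc n))) =
        (\<integral>\<^sup>+ \<omega>. \<integral>\<^sup>+ \<omega>'. ?f (Suc n) \<phi> \<omega>' \<partial>IT.eP (Suc n) \<omega> \<partial>?C (Suc n))"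
      unfolding IT.C.simps(2)[of 0 "Suc n"] add_0
      by (rule nn_integral_bind[OF meas eP])
    also have "\<dots> = (\<integral>\<^sup>+ \<omega>. ?f n (killed_step (step_pmf S M) x \<phi>) \<omega> \<partial>?C (Suc n))"
    proof (rule nn_integral_cong)
      fix \<omega> assume "\<omega> \<in> space (?C (Suc n))"
      then have \<omega>: "\<omega> \<in> space (?PiM (Suc n))"
        using IT.space_C[of "\<lambda>_. undefined" 0 "Suc n"] by (simp add: space_PiM del: IT.C.simps)
      have "(\<integral>\<^sup>+ \<omega>'. ?f (Suc n) \<phi> \<omega>' \<partial>IT.eP (Suc n) \<omega>) =
          (\<integral>\<^sup>+ b. ?f (Suc n) \<phi> (fun_upd \<omega> (Suc n) b) \<partial>walk_kernel S M y (Suc n) \<omega>)"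
        by (rule IT.nn_integral_eP[OF \<omega> meas])
      also have "\<dots> = (\<integral>\<^sup>+ b. (if \<forall>i<Suc n. \<omega> i \<noteq> x then \<phi> b else 0)
          \<partial>measure_pmf (step_pmf S M (\<omega> n)))"
        by (auto simp: walk_kernel_def intro!: nn_integral_cong)
      also have "\<dots> = ?f n (killed_step (step_pmf S M) x \<phi>) \<omega>"
      proof -
        have if_int: "(\<integral>\<^sup>+ b. (if A \<and> Q then \<phi> b else 0) \<partial>measure_pmf p) =
            (if Q then if A then \<integral>\<^sup>+ b. \<phi> b \<partial>measure_pmf p else 0 else 0)" for A Q p
          by simp
        show ?thesis
          unfolding All_less_Suc killed_step_def if_int by auto
      qed
      finally show "(\<integral>\<^sup>+ \<omega>'. ?f (Suc n) \<phi> \<omega>' \<partial>IT.eP (Suc n) \<omega>) =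
          ?f n (killed_step (step_pmf S M) x \<phi>) \<omega>" .
    qed
    also have "\<dots> = (killed_step (step_pmf S M) x ^^ Suc n) \<phi> y"
      by (simp only: Suc.IH[of "killed_step (step_pmf S M) x \<phi>"] funpow_Suc_right comp_apply)
    finally show ?case .
  qed
  finally show ?thesis .
qed

lemma expected_hitting_eq_suminf:
  "expected_hitting S M x y =
     (\<Sum>n. (killed_step (step_pmf S M) x ^^ n) (\<lambda>a. if a = x then 0 else 1) y)"
proof -
  interpret IT: Ionescu_Tulcea "walk_kernel S M y" "\<lambda>_. count_space UNIV"
    by (rule Ionescu_Tulcea_walk_kernel)
  have sets: "sets (walk_measure S M y) = sets (PiM UNIV (\<lambda>_. count_space UNIV))"
    unfolding walk_measure_def by (rule IT.PF.sets_lim)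
  have "expected_hitting S M x y = (\<integral>\<^sup>+ \<omega>. (\<Sum>n. if \<forall>i<n. \<omega> i \<noteq> x
      then if \<omega> n = x then 0 else 1 else 0) \<partial>walk_measure S M y)"
    by (simp add: expected_hitting_def hitting_time_eq_suminf)
  also have "\<dots> = (\<Sum>n. \<integral>\<^sup>+ \<omega>. (if \<forall>i<n. \<omega> i \<noteq> x
      then if \<omega> n = x then 0 else 1 else 0) \<partial>walk_measure S M y)"
    by (intro nn_integral_suminf, unfold measurable_cong_sets[OF sets refl])
      (rule measurable_killed_trajectory, simp)
  also have "\<dots> = (\<Sum>n. (killed_step (step_pmf S M) x ^^ n) (\<lambda>a. if a = x then 0 else 1) y)"
    by (intro suminf_cong nn_integral_walk_killed)
  finally show ?thesis .
qed


section \<open>Lumping a Markov chain\<close>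

text \<open>Composition with \<open>g\<close> intertwines the two killed operators, hence also their iterates.
  A killed operator never uses the law of a step out of its target, so the chains are compared only
  off the target; on a one-vertex graph the step out of the target is indeed unspecified.\<close>

lemma expected_hitting_image:
  assumes lump: "\<And>a. a \<noteq> x \<Longrightarrow> map_pmf g (step_pmf S M a) = step_pmf T N (g a)"
    and target: "\<And>a. g a = g x \<Longrightarrow> a = x"
  shows "expected_hitting S M x y = expected_hitting T N (g x) (g y)"
proof -
  let ?k = "killed_step (step_pmf S M) x" and ?l = "killed_step (step_pmf T N) (g x)"
  have step: "?k (\<lambda>a. \<phi> (g a)) = (\<lambda>a. ?l \<phi> (g a))" for \<phi>
  proof
    show "?k (\<lambda>a. \<phi> (g a)) a = ?l \<phi> (g a)" for a
    proof (cases "a = x")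
      case False
      with target have "g a \<noteq> g x" by blast
      with False show ?thesis
        unfolding killed_step_def lump[OF False, symmetric] by simp
    qed (simp add: killed_step_def)
  qed
  have iterate: "(?k ^^ n) (\<lambda>a. \<phi> (g a)) = (\<lambda>a. (?l ^^ n) \<phi> (g a))" for n \<phi>
  proof (induction n)
    case (Suc n)
    then show ?case using step[of "(?l ^^ n) \<phi>"] by simp
  qed simp
  have "(\<lambda>a. if a = x then 0 else 1 :: ennreal) = (\<lambda>a. if g a = g x then 0 else 1)"
    using target by auto
  then show ?thesis
    using iterate[of _ "\<lambda>b. if b = g x then 0 else 1"]
    by (simp add: expected_hitting_eq_suminf)
qed

lemma pmf_step_pmf:
  assumes S: "finite S" and j: "j \<in> S"
    and nonneg: "\<And>i. i \<in> S \<Longrightarrow> 0 \<le> M i j"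
    and pos: "0 < (\<Sum>l\<in>S. M l j)"
  shows "pmf (step_pmf S M j) i = trans_matrix S M i j"
  unfolding step_pmf_def
proof (rule pmf_embed_pmf)
  show nn: "0 \<le> trans_matrix S M i j" for i
    using nonneg pos by (auto simp: trans_matrix_def)
  have "(\<integral>\<^sup>+ i. ennreal (trans_matrix S M i j) \<partial>count_space UNIV) =
      (\<Sum>i\<in>S. ennreal (trans_matrix S M i j))"
    by (rule nn_integral_count_space') (use S in \<open>auto simp: trans_matrix_def\<close>)
  also have "\<dots> = ennreal (\<Sum>i\<in>S. trans_matrix S M i j)"
    using nn by (intro sum_ennreal) auto
  also have "(\<Sum>i\<in>S. trans_matrix S M i j) = 1"
    using j pos by (simp add: trans_matrix_def sum_divide_distrib[symmetric])
  finally show "(\<integral>\<^sup>+ i. ennreal (trans_matrix S M i j) \<partial>count_space UNIV) = 1" by simp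
qed

text \<open>The normalization of columns in \<open>trans_matrix\<close> absorbs the factor \<open>s\<close>, so block sums have to
  match the lumped column only up to scaling.\<close>

lemma map_step_pmf_lump:
  assumes S: "finite S" and j: "j \<in> S"
    and nonneg: "\<And>i. i \<in> S \<Longrightarrow> 0 \<le> M i j"
    and pos: "0 < (\<Sum>l\<in>S. M l j)"
    and s: "0 < s"
    and fibre: "\<And>b. b \<in> g ` S \<Longrightarrow> (\<Sum>i\<in>{i\<in>S. g i = b}. M i j) = s * N b (g j)"
  shows "map_pmf g (step_pmf S M j) = step_pmf (g ` S) N (g j)"
proof (rule pmf_eqI)
  fix b
  have total: "(\<Sum>l\<in>S. M l j) = s * (\<Sum>b\<in>g ` S. N b (g j))"
    using sum.image_gen[OF S, of "\<lambda>i. M i j" g] fibre by (simp add: sum_distrib_left)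
  have N_nonneg: "0 \<le> N b (g j)" if "b \<in> g ` S" for b
    using fibre[OF that] sum_nonneg[of "{i\<in>S. g i = b}" "\<lambda>i. M i j"] nonneg s
    by (simp add: zero_le_mult_iff)
  have N_pos: "0 < (\<Sum>b\<in>g ` S. N b (g j))"
    using pos s unfolding total by (simp add: zero_less_mult_iff)
  have step: "pmf (step_pmf S M j) i = trans_matrix S M i j" for i
    by (rule pmf_step_pmf) (use S j nonneg pos in auto)
  have "pmf (map_pmf g (step_pmf S M j)) b = measure (step_pmf S M j) (g -` {b})"
    by (rule pmf_map)
  also have "\<dots> = measure (step_pmf S M j) {i\<in>S. g i = b}"
  proof (rule measure_pmf.finite_measure_eq_AE)
    have "i \<in> S" if "i \<in> set_pmf (step_pmf S M j)" for i
      using that by (rule contrapos_pp) (simp add: set_pmf_iff step trans_matrix_def)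
    then show "AE i in step_pmf S M j. (i \<in> g -` {b}) = (i \<in> {i\<in>S. g i = b})"
      by (auto simp: AE_measure_pmf_iff)
  qed simp_all
  also have "\<dots> = (\<Sum>i\<in>{i\<in>S. g i = b}. trans_matrix S M i j)"
    using S by (simp add: measure_measure_pmf_finite step)
  also have "\<dots> = (\<Sum>i\<in>{i\<in>S. g i = b}. M i j) / (\<Sum>l\<in>S. M l j)"
    using j by (simp add: trans_matrix_def sum_divide_distrib)
  also have "\<dots> = trans_matrix (g ` S) N b (g j)"
  proof (cases "b \<in> g ` S")
    case True
    then show ?thesis using j s by (simp add: fibre total trans_matrix_def)
  next
    case False
    then have "{i\<in>S. g i = b} = {}" by auto
    then show ?thesis using False by (simp only:) (simp add: trans_matrix_def)
  qed
  also have "\<dots> = pmf (step_pmf (g ` S) N (g j)) b"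
    by (rule pmf_step_pmf[symmetric]) (use S j N_nonneg N_pos in auto)
  finally show "pmf (map_pmf g (step_pmf S M j)) b = pmf (step_pmf (g ` S) N (g j)) b" .
qed

lemma expected_hitting_lump:
  fixes M :: "'v::finite \<Rightarrow> 'v \<Rightarrow> real"
  assumes nonneg: "\<And>i j. 0 \<le> M i j"
    and pos: "\<And>j. j \<noteq> x \<Longrightarrow> 0 < (\<Sum>i\<in>UNIV. M i j)"
    and s: "\<And>j. 0 < s j"
    and fibre: "\<And>b j. b \<in> range g \<Longrightarrow> (\<Sum>i | g i = b. M i j) = s j * N b (g j)"
    and target: "\<And>a. g a = g x \<Longrightarrow> a = x"
  shows "expected_hitting UNIV M x y = expected_hitting (range g) N (g x) (g y)"
proof (rule expected_hitting_image[OF _ target])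
  fix j assume "j \<noteq> x"
  show "map_pmf g (step_pmf UNIV M j) = step_pmf (range g) N (g j)"
  proof (rule map_step_pmf_lump)
    show "0 < s j" by (rule s)
    show "0 < (\<Sum>i\<in>UNIV. M i j)" using \<open>j \<noteq> x\<close> by (rule pos)
    show "(\<Sum>i\<in>{i\<in>UNIV. g i = b}. M i j) = s j * N b (g j)" if "b \<in> range g" for b
      using fibre[OF that] by simp
  qed (simp_all add: nonneg)
qed

section \<open>Block structure of the weight vector\<close>

lemma connected_graph_nbrs_nonempty:
  assumes "connected_graph E" and "u \<noteq> v"
  shows "nbrs E u \<noteq> {}"
proof -
  from assms have "E\<^sup>*\<^sup>* u v" by (simp add: connected_graph_def)
  then show ?thesis
    using \<open>u \<noteq> v\<close> by (cases rule: converse_rtranclpE) (auto simp: nbrs_def)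
qed

text \<open>If \<open>\<nu>\<close> has constant value \<open>\<alpha>\<close> on a block \<open>Q\<close>, then a vertex \<open>w\<close> with \<open>n\<close> neighbours in \<open>Q\<close>
  has relative weight \<open>n \<alpha> / \<nu> $ w\<close> there. Within a block both \<open>n\<close> and this weight are constant, and
  if \<open>n \<noteq> 0\<close> so is \<open>\<nu>\<close>. Thus constancy passes from a block to every adjacent one, and by
  connectedness it reaches all blocks once it holds on one; a singleton block is the start.\<close>

lemma weight_constant_on_blocks:
  assumes conn: "connected_graph E"
    and pos: "\<And>u. 0 < \<nu> $ u"
    and eq: "equitable E I P" and weq: "weight_equitable E \<nu> I P"
    and z: "P k = {z}" "k \<in> I"
  shows "\<forall>i\<in>I. \<forall>u\<in>P i. \<forall>w\<in>P i. \<nu> $ u = \<nu> $ w"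
proof (intro ballI)
  fix i u w assume "i \<in> I" "u \<in> P i" "w \<in> P i"
  from conn have sym: "symp E" and "E\<^sup>*\<^sup>* z u" by (auto simp: connected_graph_def)
  from eq have cover: "(\<Union>i\<in>I. P i) = UNIV" and disj: "disjoint_family_on P I"
    by (auto simp: equitable_def indexed_partition_def)
  from \<open>E\<^sup>*\<^sup>* z u\<close> have "\<forall>i\<in>I. u \<in> P i \<longrightarrow> (\<forall>w\<in>P i. \<nu> $ u = \<nu> $ w)"
  proof (induction rule: rtranclp_induct)
    case base
    show ?case
    proof (intro ballI impI)
      fix i w assume "i \<in> I" "z \<in> P i" "w \<in> P i"
      with z disj have "i = k" by (auto simp: disjoint_family_on_def)
      with z \<open>w \<in> P i\<close> show "\<nu> $ z = \<nu> $ w" by simp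
    qed
  next
    case (step a b)
    from cover obtain i where i: "i \<in> I" "a \<in> P i" by blast
    show ?case
    proof (intro ballI impI)
      fix j w assume j: "j \<in> I" "b \<in> P j" "w \<in> P j"
      have IH: "\<nu> $ c = \<nu> $ a" if "c \<in> P i" for c
        by (rule bspec[OF mp[OF bspec[OF step.IH i(1)] i(2)] that, symmetric])
      have weight: "rel_weight E \<nu> (P i) c = real (card (nbrs E c \<inter> P i)) * \<nu> $ a / \<nu> $ c" for c
      proof -
        have "(\<Sum>v\<in>nbrs E c \<inter> P i. \<nu> $ v) = (\<Sum>v\<in>nbrs E c \<inter> P i. \<nu> $ a)"
          by (intro sum.cong refl) (simp add: IH)
        then show ?thesis by (simp add: rel_weight_def)
      qed
      have "card (nbrs E b \<inter> P i) = card (nbrs E w \<inter> P i)"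
        using bspec[OF bspec[OF eq[unfolded equitable_def, THEN conjunct2] i(1)] j(1)] j(2,3)
        by auto
      moreover have "rel_weight E \<nu> (P i) b = rel_weight E \<nu> (P i) w"
        using bspec[OF bspec[OF weq[unfolded weight_equitable_def, THEN conjunct2] i(1)] j(1)] j(2,3)
        by auto
      moreover have "a \<in> nbrs E b \<inter> P i"
        using step.hyps i sympD[OF sym] by (auto simp: nbrs_def)
      then have "card (nbrs E b \<inter> P i) \<noteq> 0" by auto
      ultimately show "\<nu> $ b = \<nu> $ w"
        using pos[of a] pos[of b] pos[of w] by (auto simp: weight field_simps)
    qed
  qed
  then show "\<nu> $ u = \<nu> $ w"
    using \<open>i \<in> I\<close> \<open>u \<in> P i\<close> \<open>w \<in> P i\<close> by blast
qed

section \<open>Hitting times in weakly equitable graphs\<close>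

lemma nonempty_part_labels:
  assumes "labelling C X f"
  shows "nonempty_labels (part_labels X f z) (fblock f z) = range (f z)"
proof -
  have "f z u \<in> insert (f z z) X" for u
    using assms by (cases "u = z") (auto simp: labelling_def)
  then show ?thesis
    by (auto simp: nonempty_labels_def part_labels_def fblock_def)
qed

theorem theorem3p3:
  fixes E :: "'v::finite \<Rightarrow> 'v \<Rightarrow> bool"
    and \<nu> :: "real ^ 'v"
    and C X :: "'l set"
    and f :: "'v \<Rightarrow> 'v \<Rightarrow> 'l"
    and L :: "'l \<Rightarrow> 'l set"
    and B :: "'l \<Rightarrow> 'l \<Rightarrow> 'l \<Rightarrow> real"
    and u v z :: 'v
  assumes "connected_graph E"
    and "perron_eigenvector (adj_matrix E) \<nu>"
    and "weakly_f_equitable E \<nu> C X f"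
    and "quotient_graphs E X f L B"
    and "f z z = f v v"
  shows "H_simple E v u = expected_hitting (L (f v v)) (B (f v v)) (f v v) (f v u) \<and>
    H_maxent E \<nu> v u =
      expected_hitting (L (f v v)) (diag_conj (D_diag \<nu> f z) (B (f v v))) (f v v) (f v u)"
proof -
  note conn = \<open>connected_graph E\<close> and color = \<open>f z z = f v v\<close>
  from \<open>perron_eigenvector (adj_matrix E) \<nu>\<close> have pos: "0 < \<nu> $ a" for a
    by (simp add: perron_eigenvector_def)
  from \<open>weakly_f_equitable E \<nu> C X f\<close> have wf: "weakly_weight_f_equitable E \<nu> C X f"
    and eq: "equitable E (part_labels X f a) (fblock f a)" for a
    by (auto simp: weakly_f_equitable_def)
  from wf have lab: "labelling C X f" and single: "fblock f a (f a a) = {a}"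
    and weq: "weight_equitable E \<nu> (part_labels X f a) (fblock f a)" for a
    by (auto simp: weakly_weight_f_equitable_def)
  note labels = nonempty_part_labels[OF lab]
  from wf obtain L' W where LW:
    "\<forall>a. nonempty_labels (part_labels X f a) (fblock f a) = L' (f a a) \<and>
       is_weight_quotient_matrix E \<nu> (part_labels X f a) (fblock f a) (W (f a a))"
    unfolding weakly_weight_f_equitable_def by (elim conjE exE) (rule that)
  then have W: "is_weight_quotient_matrix E \<nu> (part_labels X f a) (fblock f a) (W (f a a))" for a
    by simp
  have L: "L (f a a) = range (f a)" for a
    using \<open>quotient_graphs E X f L B\<close> by (simp add: quotient_graphs_def labels)
  have B: "real (card {i. E j i \<and> f a i = b}) = B (f a a) b (f a j)" if "b \<in> range (f a)" for a b j
    using \<open>quotient_graphs E X f L B\<close> that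
    by (auto simp: quotient_graphs_def labels is_quotient_matrix_def fblock_def nbrs_def Int_def)
  have sym: "E i j \<longleftrightarrow> E j i" for i j
    using conn by (auto simp: connected_graph_def dest: sympD)
  have target: "a = v" if "f v a = f v v" for a
    using single[of v] that by (auto simp: fblock_def)

  have const: "\<nu> $ i = \<nu> $ j" if "f a i = f a j" for a i j
  proof -
    have "f a j \<in> part_labels X f a"
      using labels[of a] by (auto simp: nonempty_labels_def)
    have "f a a \<in> part_labels X f a"
      by (simp add: part_labels_def)
    then have const_block:
      "\<forall>x\<in>part_labels X f a. \<forall>u\<in>fblock f a x. \<forall>w\<in>fblock f a x. \<nu> $ u = \<nu> $ w"
      by (rule weight_constant_on_blocks[OF conn pos eq weq single])
    from that have "i \<in> fblock f a (f a j)" and "j \<in> fblock f a (f a j)"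
      by (simp_all add: fblock_def)
    then show ?thesis
      by (rule bspec[OF bspec[OF bspec[OF const_block \<open>f a j \<in> part_labels X f a\<close>]]])
  qed
  have D: "D_diag \<nu> f z (f z i) = \<nu> $ i" for i
    unfolding D_diag_def by (rule the_equality) (auto simp: fblock_def intro: const)
  have Wv: "(\<Sum>i | f v i = b \<and> E j i. \<nu> $ i) = \<nu> $ j * W (f v v) b (f v j)"
    if "b \<in> range (f v)" for b j
  proof -
    have "rel_weight E \<nu> (fblock f v b) j = W (f v v) b (f v j)"
      using W[of v] that by (auto simp: is_weight_quotient_matrix_def labels fblock_def)
    then show ?thesis
      using pos[of j] by (simp add: rel_weight_def field_simps nbrs_def fblock_def Int_def conj_commute)
  qed
  \<comment> \<open>\<open>W\<close> is evaluated at a vertex \<open>k\<close> whose label in \<open>P\<^sub>z\<close> is that of \<open>j\<close> in \<open>P\<^sub>v\<close>. Working in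
    \<open>P\<^sub>z\<close> brings in the block values collected in \<open>D\<close>, while \<open>W\<close> and \<open>B\<close> are the same for \<open>z\<close>
    and \<open>v\<close>.\<close>
  have DBD: "diag_conj (D_diag \<nu> f z) (B (f v v)) b (f v j) = W (f v v) b (f v j)"
    if "b \<in> range (f v)" for b j
  proof -
    from L[of z] L[of v] color have range: "range (f z) = range (f v)" by simp
    with that obtain i where i: "b = f z i" by auto
    from range obtain k where k: "f v j = f z k" by (metis rangeE rangeI)
    have "W (f v v) b (f v j) = rel_weight E \<nu> (fblock f z b) k"
      using W[of z] color by (auto simp: is_weight_quotient_matrix_def labels fblock_def i k)
    also have "\<dots> = 1 / \<nu> $ k * (\<Sum>l | E k l \<and> f z l = b. \<nu> $ i)"
      unfolding rel_weight_def
      by (intro arg_cong2[where f = "(*)"] sum.cong refl)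
        (auto simp: nbrs_def fblock_def i intro: const)
    also have "\<dots> = diag_conj (D_diag \<nu> f z) (B (f v v)) b (f v j)"
      using B[of b z k] color i by (simp add: diag_conj_def D k divide_inverse)
    finally show ?thesis by simp
  qed

  \<comment> \<open>A vertex without neighbours is the only vertex, hence the target.\<close>
  have nonempty: "nbrs E j \<noteq> {}" if "j \<noteq> v" for j
    using connected_graph_nbrs_nonempty[OF conn that] .
  have "H_simple E v u = expected_hitting (range (f v)) (B (f v v)) (f v v) (f v u)"
    unfolding H_simple_def
  proof (rule expected_hitting_lump[where s = "\<lambda>_. 1"])
    fix j assume "j \<noteq> v"
    then have "0 < (\<Sum>i\<in>nbrs E j. 1 :: real)"
      using nonempty by (intro sum_pos) auto
    then show "0 < (\<Sum>i\<in>UNIV. adj_matrix E $ i $ j)"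
      by (simp add: adj_matrix_def sym[of _ j] nbrs_def sum.If_cases)
  next
    fix b j assume "b \<in> range (f v)"
    then show "(\<Sum>i | f v i = b. adj_matrix E $ i $ j) = 1 * B (f v v) b (f v j)"
      by (simp add: adj_matrix_def sym[of _ j] B[symmetric] sum.If_cases Int_def conj_commute)
  qed (auto simp: adj_matrix_def target)
  moreover have "H_maxent E \<nu> v u =
      expected_hitting (range (f v)) (diag_conj (D_diag \<nu> f z) (B (f v v))) (f v v) (f v u)"
  proof -
    have entry: "(diag_matrix \<nu> ** adj_matrix E) $ i $ j = (if E j i then \<nu> $ i else 0)" for i j
    proof -
      have "(diag_matrix \<nu> ** adj_matrix E) $ i $ j = \<nu> $ i * adj_matrix E $ i $ j"
        by (simp add: matrix_matrix_mult_def diag_matrix_def mult_delta_left)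
      then show ?thesis by (simp add: adj_matrix_def sym[of i j])
    qed
    show ?thesis
      unfolding H_maxent_def entry
    proof (rule expected_hitting_lump[where s = "\<lambda>j. \<nu> $ j"])
      fix j assume "j \<noteq> v"
      then have "0 < (\<Sum>i\<in>nbrs E j. \<nu> $ i)"
        using nonempty pos by (intro sum_pos) auto
      then show "0 < (\<Sum>i\<in>UNIV. if E j i then \<nu> $ i else 0)"
        by (simp add: nbrs_def sum.If_cases)
    next
      fix b j assume b: "b \<in> range (f v)"
      then show "(\<Sum>i | f v i = b. if E j i then \<nu> $ i else 0) =
          \<nu> $ j * diag_conj (D_diag \<nu> f z) (B (f v v)) b (f v j)"
        using Wv[OF b] by (simp add: DBD sum.If_cases Int_def)
    qed (use pos in \<open>auto simp: less_imp_le target\<close>)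
  qed
  ultimately show ?thesis by (simp add: L)
qed

end
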